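(* Let $\phi=(\phi_l)_{l=1,\dots,L}$ with $\phi_l\in L_2(\Omega_l)$ for all $l=1,\dots,L$, and let $\phi_{jk,lg}:=\langle\phi_l,w_{jk,lg}\rangle_{L_2(\Omega_l)}$. Then for all $j,k\in\mathbb{Z}$ and $g=1,\dots,G$ there holds $$\langle(A\phi)_g,w_{jk}\rangle_{L_2(\Omega_A)}=(2T)\sum_{l=1}^Lc_{l,g}^{-1}\,w_{jk}(\alpha_gh_l/c_{l,g})\,\phi_{jk,lg}.$$
   Context: Let $\Omega_A\subset\mathbb{R}^2$ be a (measurable) set (telescope aperture). There are $L\ge1$ layers at heights $0\le h_1<\dots<h_L$ and $G=G_{\mathrm{NGS}}+G_{\mathrm{LGS}}\ge1$ guide stars with directions $\alpha_g\in\mathbb{R}^2$, $g=1,\dots,G$; $h_{\mathrm{LGS}}>h_L$ is a given height. Put $c_{l,g}=1$ for $g\in\{1,\dots,G_{\mathrm{NGS}}\}$ and $c_{l,g}=1-h_l/h_{\mathrm{LGS}}$ for $g\in\{G_{\mathrm{NGS}}+1,\dots,G\}$, so $0<c_{l,g}\le1$. Let $\Omega_l:=\bigcup_{g=1}^G(c_{l,g}\Omega_A+\alpha_gh_l)$. The atmospheric tomography operator is $A:\prod_{l=1}^LL_2(\Omega_l)\to L_2(\Omega_A)^G$, $(A\phi)_g(r):=\sum_{l=1}^L\phi_l(c_{l,g}r+\alpha_gh_l)$, $g=1,\dots,G$. All $L_2$ spaces are complex with $\langle f,h\rangle=\int f\overline h$. Let $T>0$, $\Omega_T:=[-T,T]^2$,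 with $T$ so large that $\Omega_A\subset\Omega_T$ and $\Omega_l\subset c_{l,g}\Omega_T$ for all $l,g$. For $j,k\in\mathbb{Z}$ let $w_{jk}(x,y):=\frac1{2T}e^{ij\omega x}e^{ik\omega y}$, $\omega:=\pi/T$, and $w_{jk,lg}(x,y):=c_{l,g}^{-1}w_{jk}((x,y)/c_{l,g})\,I_{c_{l,g}\Omega_A+\alpha_gh_l}(x,y)$, where $I_M$ is the indicator function of $M$. *)

theory Defs
  imports "HOL-Analysis.Analysis"
begin

text \<open>Elements of \<open>L\<^sub>2(M)\<close> are represented by functions on the whole plane of which only
  the restriction to \<open>M\<close> matters; functions that agree almost everywhere on \<open>M\<close> are not identified,
  so a statement about all members of \<open>L2 M\<close> is a statement about all representatives.\<close>

definition L2 :: "(real^2) set \<Rightarrow> (real^2 \<Rightarrow> complex) set" where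
  "L2 M = {f \<in> borel_measurable (lebesgue_on M). integrable (lebesgue_on M) (\<lambda>x. (cmod (f x))\<^sup>2)}"

definition L2_inner :: "(real^2) set \<Rightarrow> (real^2 \<Rightarrow> complex) \<Rightarrow> (real^2 \<Rightarrow> complex) \<Rightarrow> complex" where
  "L2_inner M f h = (\<integral>x. f x * cnj (h x) \<partial>lebesgue_on M)"

text \<open>Layers are numbered \<open>1, \<dots>, L\<close> and guide stars \<open>1, \<dots>, G\<close>; the natural guide stars are the
  first \<open>G_NGS\<close> of them.  The scaling factors are passed to the later definitions as a
  function \<open>c\<close> of the layer \<open>l\<close> and the guide star \<open>g\<close>.\<close>

definition cone_scale :: "nat \<Rightarrow> real \<Rightarrow> (nat \<Rightarrow> real) \<Rightarrow> nat \<Rightarrow> nat \<Rightarrow> real" where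
  "cone_scale G_NGS h_LGS h l g = (if g \<le> G_NGS then 1 else 1 - h l / h_LGS)"

definition footprint ::
  "(real^2) set \<Rightarrow> (nat \<Rightarrow> real) \<Rightarrow> (nat \<Rightarrow> real^2) \<Rightarrow> (nat \<Rightarrow> nat \<Rightarrow> real) \<Rightarrow> nat \<Rightarrow> nat \<Rightarrow> (real^2) set"
where
  "footprint \<Omega>_A h \<alpha> c l g = (\<lambda>r. c l g *\<^sub>R r + h l *\<^sub>R \<alpha> g) ` \<Omega>_A"

definition layer_domain ::
  "nat \<Rightarrow> (real^2) set \<Rightarrow> (nat \<Rightarrow> real) \<Rightarrow> (nat \<Rightarrow> real^2) \<Rightarrow> (nat \<Rightarrow> nat \<Rightarrow> real) \<Rightarrow> nat \<Rightarrow> (real^2) set"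
where
  "layer_domain G \<Omega>_A h \<alpha> c l = (\<Union>g\<in>{1..G}. footprint \<Omega>_A h \<alpha> c l g)"

definition tomography_op ::
  "nat \<Rightarrow> (nat \<Rightarrow> real) \<Rightarrow> (nat \<Rightarrow> real^2) \<Rightarrow> (nat \<Rightarrow> nat \<Rightarrow> real) \<Rightarrow>
   (nat \<Rightarrow> real^2 \<Rightarrow> complex) \<Rightarrow> nat \<Rightarrow> real^2 \<Rightarrow> complex"
where
  "tomography_op L h \<alpha> c \<phi> g r = (\<Sum>l=1..L. \<phi> l (c l g *\<^sub>R r + h l *\<^sub>R \<alpha> g))"

definition square :: "real \<Rightarrow> (real^2) set" where
  "square T = {x. \<forall>i. x $ i \<in> {-T..T}}"

definition w :: "real \<Rightarrow> int \<Rightarrow> int \<Rightarrow> real^2 \<Rightarrow> complex" where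
  "w T j k x = (let \<omega> = pi / T in
     1 / (2 * of_real T) * exp (\<i> * of_int j * of_real \<omega> * of_real (x $ 1))
                         * exp (\<i> * of_int k * of_real \<omega> * of_real (x $ 2)))"

definition w_frame ::
  "real \<Rightarrow> (real^2) set \<Rightarrow> (nat \<Rightarrow> real) \<Rightarrow> (nat \<Rightarrow> real^2) \<Rightarrow> (nat \<Rightarrow> nat \<Rightarrow> real) \<Rightarrow>
   int \<Rightarrow> int \<Rightarrow> nat \<Rightarrow> nat \<Rightarrow> real^2 \<Rightarrow> complex"
where
  "w_frame T \<Omega>_A h \<alpha> c j k l g x =
     of_real (inverse (c l g)) * w T j k (x /\<^sub>R c l g) * indicator (footprint \<Omega>_A h \<alpha> c l g) x"

end

theory Submission
  imports Defs
begin

text \<open>The operator adds, over the layers, the pullbacks of \<open>\<phi> l\<close> under the similarities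
  \<open>r \<mapsto> c r + b\<close> with \<open>c = c l g\<close> and \<open>b = h l *\<^sub>R \<alpha> g\<close>, and each layer contributes one term to the
  claim.  Substituting \<open>x = c r + b\<close>, with Jacobian \<open>c\<^sup>2\<close> in the plane, turns the pairing of the
  pullback with \<open>w T j k\<close> over the aperture into the pairing of \<open>\<phi> l\<close> with \<open>w T j k ((x - b) / c)\<close>
  over the footprint.  As \<open>2 T w\<close> is a unitary character of the plane, this wave is
  \<open>w T j k (x / c)\<close> times a constant, and the conjugate of that constant is \<open>2 T w T j k (b / c)\<close>.
  One of the two factors \<open>1 / c\<close> of the Jacobian is absorbed into \<open>w_frame\<close>, the other one stays;
  the indicator function in \<open>w_frame\<close> cuts the layer domain down to the footprint
  (\<open>plane_wave_pairing_affine_pullback\<close>).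

  Adding the contributions requires each of them to be integrable.  This is where square
  integrability and the boundedness of the aperture enter: on a set of finite measure an \<open>L\<^sub>2\<close>
  function is integrable (\<open>L2_imp_integrable_on_bounded\<close>), and the waves are bounded.\<close>

section \<open>Similarities and Lebesgue measure\<close>

lemma similarity_as_sum_Basis:
  fixes t :: "'a::euclidean_space"
  shows "(\<lambda>x. t + (\<Sum>j\<in>Basis. (c * (x \<bullet> j)) *\<^sub>R j)) = (\<lambda>x. c *\<^sub>R x + t)"
proof
  fix x :: 'a
  have "(\<Sum>j\<in>Basis. (c * (x \<bullet> j)) *\<^sub>R j) = c *\<^sub>R (\<Sum>j\<in>Basis. (x \<bullet> j) *\<^sub>R j)"
    unfolding scaleR_sum_right scaleR_scaleR ..
  also have "\<dots> = c *\<^sub>R x"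
    unfolding euclidean_representation ..
  finally show "t + (\<Sum>j\<in>Basis. (c * (x \<bullet> j)) *\<^sub>R j) = c *\<^sub>R x + t"
    by (simp only: add.commute)
qed

lemma lebesgue_similarity_measurable:
  fixes t :: "'a::euclidean_space"
  assumes "c \<noteq> 0"
  shows "(\<lambda>x. c *\<^sub>R x + t) \<in> lebesgue \<rightarrow>\<^sub>M lebesgue"
  using lebesgue_affine_measurable[of "\<lambda>_. c" t, OF assms, unfolded similarity_as_sum_Basis] .

lemma lebesgue_similarity:
  fixes t :: "'a::euclidean_space"
  assumes "c \<noteq> 0"
  shows "(lebesgue :: 'a measure) =
    density (distr lebesgue lebesgue (\<lambda>x. c *\<^sub>R x + t)) (\<lambda>_. \<bar>c\<bar> ^ DIM('a))"
  using lebesgue_affine_euclidean[of "\<lambda>_. c" t, OF assms, unfolded similarity_as_sum_Basis prod_constant] .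

lemma
  fixes t :: "'a::euclidean_space" and f :: "'a \<Rightarrow> 'b::{banach, second_countable_topology}"
  assumes c: "c \<noteq> 0" and f: "f \<in> borel_measurable lebesgue"
  shows integrable_lebesgue_similarity_iff:
      "integrable lebesgue (\<lambda>x. f (c *\<^sub>R x + t)) \<longleftrightarrow> integrable lebesgue f"
    and integral_lebesgue_similarity:
      "integral\<^sup>L lebesgue f = \<bar>c\<bar> ^ DIM('a) *\<^sub>R (\<integral>x. f (c *\<^sub>R x + t) \<partial>lebesgue)"
proof -
  note T = lebesgue_similarity_measurable[OF c, of t]
  let ?D = "distr lebesgue lebesgue (\<lambda>x. c *\<^sub>R x + t)"
  have fD: "f \<in> borel_measurable ?D"
    using f by simp
  have "integrable lebesgue f \<longleftrightarrow> integrable ?D (\<lambda>x. \<bar>c\<bar> ^ DIM('a) *\<^sub>R f x)"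
    using arg_cong[OF lebesgue_similarity[OF c, of t], of "\<lambda>N. integrable N f"]
    by (simp only: integrable_density[OF fD] borel_measurable_const AE_I2 zero_le_power abs_ge_zero)
  also have "\<dots> \<longleftrightarrow> integrable ?D f"
  proof
    assume "integrable ?D (\<lambda>x. \<bar>c\<bar> ^ DIM('a) *\<^sub>R f x)"
    then have "integrable ?D (\<lambda>x. inverse (\<bar>c\<bar> ^ DIM('a)) *\<^sub>R (\<bar>c\<bar> ^ DIM('a) *\<^sub>R f x))"
      by (rule integrable_scaleR_right)
    then show "integrable ?D f"
      using c by simp
  qed (rule integrable_scaleR_right)
  also have "\<dots> \<longleftrightarrow> integrable lebesgue (\<lambda>x. f (c *\<^sub>R x + t))"
    by (rule integrable_distr_eq[OF T f])
  finally show "integrable lebesgue (\<lambda>x. f (c *\<^sub>R x + t)) \<longleftrightarrow> integrable lebesgue f" ..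
  have "integral\<^sup>L lebesgue f = integral\<^sup>L ?D (\<lambda>x. \<bar>c\<bar> ^ DIM('a) *\<^sub>R f x)"
    using arg_cong[OF lebesgue_similarity[OF c, of t], of "\<lambda>N. integral\<^sup>L N f"]
    by (simp only: integral_density[OF fD] borel_measurable_const AE_I2 zero_le_power abs_ge_zero)
  also have "\<dots> = \<bar>c\<bar> ^ DIM('a) *\<^sub>R integral\<^sup>L ?D f"
    by simp
  also have "integral\<^sup>L ?D f = (\<integral>x. f (c *\<^sub>R x + t) \<partial>lebesgue)"
    by (rule integral_distr[OF T f])
  finally show "integral\<^sup>L lebesgue f = \<bar>c\<bar> ^ DIM('a) *\<^sub>R (\<integral>x. f (c *\<^sub>R x + t) \<partial>lebesgue)" .
qed

lemma sets_lebesgue_similarity_image: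
  fixes t :: "'a::euclidean_space"
  assumes c: "c \<noteq> 0" and S: "S \<in> sets lebesgue"
  shows "(\<lambda>x. c *\<^sub>R x + t) ` S \<in> sets lebesgue"
proof -
  define u where "u x = inverse c *\<^sub>R (x - t)" for x
  have left: "u (c *\<^sub>R x + t) = x" and right: "c *\<^sub>R u x + t = x" for x
    using c by (simp_all add: u_def)
  have "(\<lambda>x. c *\<^sub>R x + t) ` S = u -` S"
  proof (intro set_eqI iffI)
    fix y assume "y \<in> u -` S"
    then show "y \<in> (\<lambda>x. c *\<^sub>R x + t) ` S"
      by (intro rev_image_eqI[of "u y"]) (simp_all only: vimage_eq right)
  qed (auto simp: left)
  moreover have "u = (\<lambda>x. inverse c *\<^sub>R x + (- (inverse c *\<^sub>R t)))"
    by (simp add: u_def fun_eq_iff scaleR_diff_right)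
  then have "u \<in> lebesgue \<rightarrow>\<^sub>M lebesgue"
    using c by (simp only: lebesgue_similarity_measurable inverse_nonzero_iff_nonzero not_False_eq_True)
  ultimately show ?thesis
    using measurable_sets[of u lebesgue lebesgue S] S by simp
qed

section \<open>Integrability of square integrable functions on bounded sets\<close>

text \<open>Finite measure of the bounded set makes the constant \<open>1\<close> integrable there, and \<open>1 + \<bar>f\<bar>\<^sup>2\<close>
  dominates \<open>\<bar>f\<bar>\<close>.  Integrability is phrased over the whole plane, because there the similarities
  above can be applied to it.\<close>

lemma L2_imp_integrable_on_bounded:
  assumes f: "f \<in> L2 M" and M: "M \<in> sets lebesgue"
    and S: "S \<in> sets lebesgue" "bounded S" "S \<subseteq> M"
  shows "integrable lebesgue (\<lambda>x. indicator S x *\<^sub>R f x)"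
proof (rule Bochner_Integration.integrable_bound)
  have eq: "indicator S x *\<^sub>R (indicator M x *\<^sub>R f x) = indicator S x *\<^sub>R f x" for x
    using S(3) by (auto simp: indicator_def)
  have "(\<lambda>x. indicator M x *\<^sub>R f x) \<in> borel_measurable lebesgue"
    using f M by (simp add: L2_def borel_measurable_restrict_space_iff)
  then have "(\<lambda>x. indicator S x *\<^sub>R (indicator M x *\<^sub>R f x)) \<in> borel_measurable lebesgue"
    by (rule borel_measurable_scaleR[OF borel_measurable_indicator[OF S(1)]])
  then show "(\<lambda>x. indicator S x *\<^sub>R f x) \<in> borel_measurable lebesgue"
    by (simp only: eq)
  have "S \<in> lmeasurable"
    using S bounded_set_imp_lmeasurable by blast
  then have "integrable lebesgue (indicat_real S)"
    by (simp add: lmeasurable_iff_integrable)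
  moreover have "integrable lebesgue (\<lambda>x. indicator M x *\<^sub>R (cmod (f x))\<^sup>2)"
    using f M by (simp add: L2_def integrable_restrict_space)
  ultimately show "integrable lebesgue (\<lambda>x. indicat_real S x + indicator M x *\<^sub>R (cmod (f x))\<^sup>2)"
    by (rule Bochner_Integration.integrable_add)
  have "y \<le> 1 + y\<^sup>2" for y :: real
    using zero_le_power2[of "y - 1/2"] by (simp add: power2_eq_square algebra_simps)
  then show "AE x in lebesgue. norm (indicator S x *\<^sub>R f x) \<le>
      norm (indicat_real S x + indicator M x *\<^sub>R (cmod (f x))\<^sup>2)"
    using S(3) by (intro AE_I2) (auto simp: indicator_def)
qed

section \<open>Plane waves\<close>

text \<open>The factor \<open>2 T\<close> compensates the normalisation: \<open>2 T w\<close> is the character.\<close>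

lemma w_add:
  assumes "T \<noteq> 0"
  shows "w T j k (x + y) = of_real (2 * T) * w T j k x * w T j k y"
proof -
  have e: "exp (u * of_real ((x + y) $ i)) = exp (u * of_real (x $ i)) * exp (u * of_real (y $ i))"
    for u :: complex and i
    by (simp add: distrib_left exp_add)
  show ?thesis
    unfolding w_def Let_def e using assms by simp
qed

lemma cnj_w: "cnj (w T j k x) = w T j k (- x)"
  by (simp add: w_def Let_def exp_cnj)

lemma norm_w: "cmod (w T j k x) = inverse (2 * \<bar>T\<bar>)"
proof -
  have "cmod (exp (\<i> * of_int m * of_real a * of_real b)) = 1" for m a b
    using norm_exp_i_times[of "of_int m * a * b"] by (simp add: mult.assoc)
  then have "cmod (w T j k x) = cmod (1 / (2 * of_real T))"
    by (simp only: w_def Let_def norm_mult mult_1_right)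
  also have "\<dots> = inverse (2 * \<bar>T\<bar>)"
    by (simp only: norm_divide norm_mult norm_one norm_numeral norm_of_real inverse_eq_divide)
  finally show ?thesis .
qed

lemma continuous_on_w: "continuous_on S (w T j k)"
  unfolding w_def Let_def by (intro continuous_intros)

section \<open>The contribution of one layer\<close>

text \<open>The conjugated wave, carried along the similarity \<open>x = c r + b\<close>.  Conjugation reverses the sign
  of the shift, which is why the constant is \<open>w\<close> at \<open>b / c\<close> and not at \<open>- b / c\<close>.\<close>

lemma cnj_w_affine:
  assumes "T \<noteq> 0" "c \<noteq> 0"
  shows "cnj (w T j k r) =
    of_real (2 * T) * w T j k (b /\<^sub>R c) * cnj (w T j k ((c *\<^sub>R r + b) /\<^sub>R c))"
proof -
  have e: "- r = b /\<^sub>R c + - ((c *\<^sub>R r + b) /\<^sub>R c)"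
  proof -
    have "(c *\<^sub>R r + b) /\<^sub>R c = r + b /\<^sub>R c"
      using assms(2) by (simp add: scaleR_add_right)
    then show ?thesis
      by (simp only: minus_add add_minus_cancel)
  qed
  show ?thesis
    unfolding cnj_w by (subst e) (rule w_add[OF assms(1)])
qed

lemma
  fixes S M :: "(real^2) set" and b :: "real^2"
  assumes T: "T \<noteq> 0" and c: "c \<noteq> 0"
    and S: "S \<in> sets lebesgue" "bounded S"
    and f: "f \<in> L2 M" and M: "M \<in> sets lebesgue" and sub: "(\<lambda>r. c *\<^sub>R r + b) ` S \<subseteq> M"
  shows integrable_affine_pullback_plane_wave:
      "integrable (lebesgue_on S) (\<lambda>r. f (c *\<^sub>R r + b) * cnj (w T j k r))"
    and plane_wave_pairing_affine_pullback:
      "L2_inner S (\<lambda>r. f (c *\<^sub>R r + b)) (w T j k) =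
        of_real (2 * T) * (of_real (inverse c) * w T j k (b /\<^sub>R c) *
          L2_inner M f (\<lambda>x. of_real (inverse c) * w T j k (x /\<^sub>R c)
            * indicator ((\<lambda>r. c *\<^sub>R r + b) ` S) x))"
proof -
  let ?a = "\<lambda>r. c *\<^sub>R r + b"
  let ?F = "?a ` S"
  define q where "q x = (indicator ?F x *\<^sub>R f x) * cnj (w T j k (x /\<^sub>R c))" for x
  define K where "K = of_real (2 * T) * w T j k (b /\<^sub>R c)"
  have F: "?F \<in> sets lebesgue"
    by (rule sets_lebesgue_similarity_image[OF c S(1)])
  have bF: "bounded ?F"
    using bounded_translation[OF bounded_scaling[OF S(2), of c], of b]
    by (simp add: image_image add.commute)
  have indF: "indicator ?F (?a r) = (indicator S r :: real)" for r
    using c by (auto simp: indicator_def)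
  have q: "integrable lebesgue q"
  proof (rule Bochner_Integration.integrable_bound)
    let ?p = "\<lambda>x. indicator ?F x *\<^sub>R f x"
    have p: "integrable lebesgue ?p"
      by (rule L2_imp_integrable_on_bounded[OF f M F bF sub])
    then show "integrable lebesgue (\<lambda>x. inverse (2 * \<bar>T\<bar>) *\<^sub>R ?p x)"
      by (rule integrable_scaleR_right)
    have "continuous_on UNIV (\<lambda>x. cnj (w T j k (x /\<^sub>R c)))"
      by (intro continuous_intros continuous_on_compose2[OF continuous_on_w]) auto
    then have "(\<lambda>x. cnj (w T j k (x /\<^sub>R c))) \<in> borel_measurable lebesgue"
      by (simp add: borel_measurable_continuous_onI measurable_completion)
    then show "q \<in> borel_measurable lebesgue"
      unfolding q_def using p by (intro borel_measurable_times) auto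
    show "AE x in lebesgue. norm (q x) \<le> norm (inverse (2 * \<bar>T\<bar>) *\<^sub>R ?p x)"
      by (simp add: q_def norm_mult norm_w)
  qed
  have pull: "indicator S r *\<^sub>R (f (?a r) * cnj (w T j k r)) = K * q (?a r)" for r
    using cnj_w_affine[OF T c, of j k r b] by (simp add: q_def K_def indF)
  have "integrable lebesgue (\<lambda>r. q (?a r))"
    using q c by (subst integrable_lebesgue_similarity_iff) auto
  then show "integrable (lebesgue_on S) (\<lambda>r. f (?a r) * cnj (w T j k r))"
    using S(1) by (simp add: integrable_restrict_space pull)
  have "integral\<^sup>L lebesgue q = \<bar>c\<bar> ^ DIM(real^2) *\<^sub>R (\<integral>r. q (?a r) \<partial>lebesgue)"
    using q c by (intro integral_lebesgue_similarity) auto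
  then have jac: "(\<integral>r. q (?a r) \<partial>lebesgue) = of_real (inverse c) * of_real (inverse c) * integral\<^sup>L lebesgue q"
    using c by (simp add: scaleR_conv_of_real power2_eq_square field_simps)
  have "indicator M x *\<^sub>R (f x * cnj (of_real (inverse c) * w T j k (x /\<^sub>R c) * indicator ?F x))
      = of_real (inverse c) * q x" for x
    using sub by (auto simp: q_def indicator_def)
  then have rhs: "L2_inner M f (\<lambda>x. of_real (inverse c) * w T j k (x /\<^sub>R c) * indicator ?F x)
      = of_real (inverse c) * integral\<^sup>L lebesgue q"
    using M by (simp add: L2_inner_def integral_restrict_space)
  have "L2_inner S (\<lambda>r. f (?a r)) (w T j k) = K * (\<integral>r. q (?a r) \<partial>lebesgue)"
    using S(1) by (simp add: L2_inner_def integral_restrict_space pull)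
  then show "L2_inner S (\<lambda>r. f (?a r)) (w T j k) =
      of_real (2 * T) * (of_real (inverse c) * w T j k (b /\<^sub>R c) *
        L2_inner M f (\<lambda>x. of_real (inverse c) * w T j k (x /\<^sub>R c) * indicator ?F x))"
    unfolding rhs jac K_def by (simp add: mult_ac)
qed

section \<open>The tomography operator\<close>

lemma bounded_square: "bounded (square T)"
proof -
  have "square T = cbox (\<chi> i. - T) (\<chi> i. T)"
    by (auto simp: square_def mem_box_cart)
  then show ?thesis
    by (simp add: bounded_cbox)
qed

text \<open>The laser guide stars lie above the topmost layer, so no cone has closed up at any layer.\<close>

lemma cone_scale_pos:
  assumes "0 \<le> h 1" "strict_mono_on {1..L} h" "h L < h_LGS" "l \<in> {1..L}"
  shows "0 < cone_scale G_NGS h_LGS h l g"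
proof -
  have mono: "h m \<le> h n" if "m \<in> {1..L}" "n \<in> {1..L}" "m \<le> n" for m n
    using strict_mono_onD[OF assms(2) that(1,2)] that(3) by (cases "m = n") auto
  have "h l < h_LGS" "0 \<le> h l"
    using mono[of l L] mono[of 1 l] assms by auto
  then show ?thesis
    by (simp add: cone_scale_def)
qed

theorem proposition4p4:
  fixes \<Omega>_A :: "(real^2) set" and L G_NGS G_LGS :: nat and h :: "nat \<Rightarrow> real" and h_LGS T :: real
    and \<alpha> :: "nat \<Rightarrow> real^2" and \<phi> :: "nat \<Rightarrow> real^2 \<Rightarrow> complex"
  defines "G \<equiv> G_NGS + G_LGS"
    and "c \<equiv> cone_scale G_NGS h_LGS h"
  assumes "\<Omega>_A \<in> sets lebesgue"
    and "1 \<le> L" and "1 \<le> G"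
    and "0 \<le> h 1" and "strict_mono_on {1..L} h" and "h L < h_LGS"
    and "0 < T" and "\<Omega>_A \<subseteq> square T"
    and "\<forall>l\<in>{1..L}. \<forall>g\<in>{1..G}. layer_domain G \<Omega>_A h \<alpha> c l \<subseteq> (\<lambda>x. c l g *\<^sub>R x) ` square T"
    and "\<forall>l\<in>{1..L}. \<phi> l \<in> L2 (layer_domain G \<Omega>_A h \<alpha> c l)"
  shows "\<forall>j k. \<forall>g\<in>{1..G}.
    L2_inner \<Omega>_A (tomography_op L h \<alpha> c \<phi> g) (w T j k) =
      of_real (2 * T) * (\<Sum>l=1..L. of_real (inverse (c l g)) * w T j k ((h l / c l g) *\<^sub>R \<alpha> g) *
        L2_inner (layer_domain G \<Omega>_A h \<alpha> c l) (\<phi> l) (w_frame T \<Omega>_A h \<alpha> c j k l g))"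
proof (intro allI ballI)
  fix j k g assume g: "g \<in> {1..G}"
  have T: "T \<noteq> 0"
    using \<open>0 < T\<close> by simp
  have bdd: "bounded \<Omega>_A"
    using bounded_subset[OF bounded_square \<open>\<Omega>_A \<subseteq> square T\<close>] .
  let ?M = "layer_domain G \<Omega>_A h \<alpha> c"
  let ?f = "\<lambda>l r. \<phi> l (c l g *\<^sub>R r + h l *\<^sub>R \<alpha> g)"
  have c: "c l g' \<noteq> 0" if "l \<in> {1..L}" for l g'
    using cone_scale_pos[OF \<open>0 \<le> h 1\<close> \<open>strict_mono_on {1..L} h\<close> \<open>h L < h_LGS\<close> that] c_def
    by (metis less_irrefl)
  have M: "?M l \<in> sets lebesgue" if "l \<in> {1..L}" for l
    unfolding layer_domain_def footprint_def
    by (intro sets.finite_UN sets_lebesgue_similarity_image c that \<open>\<Omega>_A \<in> sets lebesgue\<close>) auto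
  have sub: "(\<lambda>r. c l g *\<^sub>R r + h l *\<^sub>R \<alpha> g) ` \<Omega>_A \<subseteq> ?M l" for l
    using g by (auto simp: layer_domain_def footprint_def)
  have \<phi>: "\<phi> l \<in> L2 (?M l)" if "l \<in> {1..L}" for l
    using that assms(12) by blast
  have int: "integrable (lebesgue_on \<Omega>_A) (\<lambda>r. ?f l r * cnj (w T j k r))" if "l \<in> {1..L}" for l
    by (rule integrable_affine_pullback_plane_wave
        [OF T c[OF that] \<open>\<Omega>_A \<in> sets lebesgue\<close> bdd \<phi>[OF that] M[OF that] sub])
  have "L2_inner \<Omega>_A (tomography_op L h \<alpha> c \<phi> g) (w T j k) = (\<Sum>l=1..L. L2_inner \<Omega>_A (?f l) (w T j k))"
    unfolding L2_inner_def tomography_op_def sum_distrib_right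
    by (rule Bochner_Integration.integral_sum) (rule int)
  also have "\<dots> = (\<Sum>l=1..L. of_real (2 * T) * (of_real (inverse (c l g)) *
      w T j k ((h l / c l g) *\<^sub>R \<alpha> g) * L2_inner (?M l) (\<phi> l) (w_frame T \<Omega>_A h \<alpha> c j k l g)))"
  proof (rule sum.cong[OF refl])
    fix l assume l: "l \<in> {1..L}"
    have frame: "w_frame T \<Omega>_A h \<alpha> c j k l g = (\<lambda>x. of_real (inverse (c l g)) * w T j k (x /\<^sub>R c l g)
        * indicator ((\<lambda>r. c l g *\<^sub>R r + h l *\<^sub>R \<alpha> g) ` \<Omega>_A) x)"
      by (simp add: fun_eq_iff w_frame_def footprint_def)
    have shift: "(h l / c l g) *\<^sub>R \<alpha> g = (h l *\<^sub>R \<alpha> g) /\<^sub>R c l g"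
      by (simp add: divide_inverse mult.commute)
    show "L2_inner \<Omega>_A (?f l) (w T j k) = of_real (2 * T) * (of_real (inverse (c l g)) *
        w T j k ((h l / c l g) *\<^sub>R \<alpha> g) * L2_inner (?M l) (\<phi> l) (w_frame T \<Omega>_A h \<alpha> c j k l g))"
      unfolding frame shift
      by (rule plane_wave_pairing_affine_pullback
          [OF T c[OF l] \<open>\<Omega>_A \<in> sets lebesgue\<close> bdd \<phi>[OF l] M[OF l] sub])
  qed
  finally show "L2_inner \<Omega>_A (tomography_op L h \<alpha> c \<phi> g) (w T j k) =
      of_real (2 * T) * (\<Sum>l=1..L. of_real (inverse (c l g)) * w T j k ((h l / c l g) *\<^sub>R \<alpha> g) *
        L2_inner (?M l) (\<phi> l) (w_frame T \<Omega>_A h \<alpha> c j k l g))"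
    by (simp only: sum_distrib_left)
qed

end
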